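(* Let $(\mathcal{H},S_b,s)$ be a complete symmetric $S_b$-metric space, $s\ge1$, and let $\mathcal{CB}(\mathcal{H})$ be the collection of non-empty closed and bounded subsets of $\mathcal{H}$, equipped with the metric $H_b$. Let $T:\mathcal{H}\to\mathcal{CB}(\mathcal{H})$ be a continuous multi-valued map and suppose that there is $\alpha\in[0,\tfrac1s)$ such that $$H_b(Th,Th,Tg)\le \alpha\, S_b(h,h,g)\quad\text{for all } h,g\in\mathcal{H}.$$ Then $T$ has a fixed point in $\mathcal{H}$, i.e. there exists $z\in\mathcal{H}$ with $z\in Tz$.
   Context: An $S_b$-metric space is a triple $(X,S_b,s)$ where $X$ is a non-empty set, $s\ge 1$ is a real number, and $S_b:X^3\to[0,\infty)$ satisfies, for all $u,w,v,t\in X$: (i) $S_b(u,w,v)=0$ if and only if $u=w=v$; (ii) $S_b(u,w,v)\le s[S_b(u,u,t)+S_b(w,w,t)+S_b(v,v,t)]$. It is symmetric if $S_b(u,u,w)=S_b(w,w,u)$ for all $u,w\in X$. A sequence $(h_n)$ in $\mathcal{H}$ converges to $h\in\mathcal{H}$ if $S_b(h_n,h_n,h)\to 0$ as $n\to\infty$; it is Cauchy if $S_b(h_n,h_n,h_m)\to 0$ as $n,m\to\infty$; $(\mathcal{H},S_b,s)$ is complete if every Cauchy sequence converges to a point of $\mathcal{H}$. A subset $K\subseteq\mathcal{H}$ is closed if it contains every point $x\in\mathcal{H}$ that is the limit of some sequence of points of $K$. A subset $K$ is bounded if $\sup\{S_b(h,u,v): h,u,v\in K\}<\infty$. $\mathcal{CB}(\mathcal{H})$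 denotes the set of all non-empty closed and bounded subsets of $\mathcal{H}$. For $h\in\mathcal{H}$ and $R\in\mathcal{CB}(\mathcal{H})$, $D_b(h,R)=\inf\{S_b(h,h,r): r\in R\}$. For $P,Q,R\in\mathcal{CB}(\mathcal{H})$, $$H_b(P,Q,R)=\max\Big\{\max\big\{\sup_{p\in P}D_b(p,R),\ \sup_{p\in P}D_b(p,Q)\big\},\ \max\big\{\sup_{r\in R}D_b(r,P),\ \sup_{r\in R}D_b(r,Q)\big\},\ \max\big\{\sup_{q\in Q}D_b(q,P),\ \sup_{q\in Q}D_b(q,R)\big\}\Big\}.$$ Continuity of $T:\mathcal{H}\to\mathcal{CB}(\mathcal{H})$ means: whenever $h_n\to h$ in $\mathcal{H}$, $H_b(Th_n,Th_n,Th)\to0$. *)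

theory Defs
  imports Complex_Main
begin

locale Sb_metric_space =
  fixes X :: "'a set"
    and S :: "'a \<Rightarrow> 'a \<Rightarrow> 'a \<Rightarrow> real"
    and s :: real
  assumes nonempty: "X \<noteq> {}"
    and s_ge_1: "1 \<le> s"
    and nonneg: "\<lbrakk>u \<in> X; w \<in> X; v \<in> X\<rbrakk> \<Longrightarrow> 0 \<le> S u w v"
    and eq_0_iff: "\<lbrakk>u \<in> X; w \<in> X; v \<in> X\<rbrakk> \<Longrightarrow> S u w v = 0 \<longleftrightarrow> u = w \<and> w = v"
    and ineq: "\<lbrakk>u \<in> X; w \<in> X; v \<in> X; t \<in> X\<rbrakk> \<Longrightarrow> S u w v \<le> s * (S u u t + S w w t + S v v t)"

definition Sb_symmetric :: "'a set \<Rightarrow> ('a \<Rightarrow> 'a \<Rightarrow> 'a \<Rightarrow> real) \<Rightarrow> bool" where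
  "Sb_symmetric X S \<longleftrightarrow> (\<forall>u\<in>X. \<forall>w\<in>X. S u u w = S w w u)"

definition Sb_converges ::
  "'a set \<Rightarrow> ('a \<Rightarrow> 'a \<Rightarrow> 'a \<Rightarrow> real) \<Rightarrow> (nat \<Rightarrow> 'a) \<Rightarrow> 'a \<Rightarrow> bool" where
  "Sb_converges X S h l \<longleftrightarrow> range h \<subseteq> X \<and> l \<in> X \<and> (\<lambda>n. S (h n) (h n) l) \<longlonglongrightarrow> 0"

text \<open>The Cauchy condition is a double limit. No absolute value is needed, since \<open>S\<close> is
  nonnegative on the carrier.\<close>

definition Sb_Cauchy :: "'a set \<Rightarrow> ('a \<Rightarrow> 'a \<Rightarrow> 'a \<Rightarrow> real) \<Rightarrow> (nat \<Rightarrow> 'a) \<Rightarrow> bool" where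
  "Sb_Cauchy X S h \<longleftrightarrow> range h \<subseteq> X \<and>
     (\<forall>e>0. \<exists>N. \<forall>n\<ge>N. \<forall>m\<ge>N. S (h n) (h n) (h m) < e)"

definition Sb_complete :: "'a set \<Rightarrow> ('a \<Rightarrow> 'a \<Rightarrow> 'a \<Rightarrow> real) \<Rightarrow> bool" where
  "Sb_complete X S \<longleftrightarrow> (\<forall>h. Sb_Cauchy X S h \<longrightarrow> (\<exists>l\<in>X. Sb_converges X S h l))"

definition Sb_closed :: "'a set \<Rightarrow> ('a \<Rightarrow> 'a \<Rightarrow> 'a \<Rightarrow> real) \<Rightarrow> 'a set \<Rightarrow> bool" where
  "Sb_closed X S K \<longleftrightarrow> K \<subseteq> X \<and>
     (\<forall>x\<in>X. (\<exists>h. range h \<subseteq> K \<and> Sb_converges X S h x) \<longrightarrow> x \<in> K)"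

definition Sb_bounded :: "'a set \<Rightarrow> ('a \<Rightarrow> 'a \<Rightarrow> 'a \<Rightarrow> real) \<Rightarrow> 'a set \<Rightarrow> bool" where
  "Sb_bounded X S K \<longleftrightarrow> K \<subseteq> X \<and> bdd_above {S h u v |h u v. h \<in> K \<and> u \<in> K \<and> v \<in> K}"

definition CB :: "'a set \<Rightarrow> ('a \<Rightarrow> 'a \<Rightarrow> 'a \<Rightarrow> real) \<Rightarrow> 'a set set" where
  "CB X S = {K. K \<noteq> {} \<and> Sb_closed X S K \<and> Sb_bounded X S K}"

text \<open>For nonempty bounded sets in an \<open>S\<^sub>b\<close>-metric space, the infima below are over nonempty sets
  bounded below by \<open>0\<close>, and the suprema over nonempty sets that are bounded above. Hence the
  infimum and supremum of reals take their usual values.\<close>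

definition D_b :: "('a \<Rightarrow> 'a \<Rightarrow> 'a \<Rightarrow> real) \<Rightarrow> 'a \<Rightarrow> 'a set \<Rightarrow> real" where
  "D_b S h R = (INF r\<in>R. S h h r)"

definition H_b :: "('a \<Rightarrow> 'a \<Rightarrow> 'a \<Rightarrow> real) \<Rightarrow> 'a set \<Rightarrow> 'a set \<Rightarrow> 'a set \<Rightarrow> real" where
  "H_b S P Q R =
     Max {max (SUP p\<in>P. D_b S p R) (SUP p\<in>P. D_b S p Q),
          max (SUP r\<in>R. D_b S r P) (SUP r\<in>R. D_b S r Q),
          max (SUP q\<in>Q. D_b S q P) (SUP q\<in>Q. D_b S q R)}"

definition Sb_multi_continuous ::
  "'a set \<Rightarrow> ('a \<Rightarrow> 'a \<Rightarrow> 'a \<Rightarrow> real) \<Rightarrow> ('a \<Rightarrow> 'a set) \<Rightarrow> bool" where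
  "Sb_multi_continuous X S T \<longleftrightarrow>
     (\<forall>h l. Sb_converges X S h l \<longrightarrow> (\<lambda>n. H_b S (T (h n)) (T (h n)) (T l)) \<longlonglongrightarrow> 0)"

end

theory Submission
  imports Defs
begin

text \<open>This is Nadler's iteration. If no point is fixed, then \<open>S x x y > 0\<close> whenever \<open>y \<in> T x\<close>, so
  for a rate \<open>k\<close> with \<open>\<alpha> < k < 1/s\<close> some \<open>z \<in> T y\<close> has \<open>S y y z < k * S x x y\<close>, and one gets an orbit
  whose steps decay like \<open>k ^ n\<close>. In \<open>S u u v \<le> s * (2 * S u u t + S t t v)\<close> the remainder
  \<open>S t t v\<close> carries only the factor \<open>s\<close>, not \<open>2 * s\<close>; hence \<open>s * k < 1\<close> suffices for the orbit to be
  Cauchy. Its limit is approximated by points of its own image, which is closed.\<close>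

context Sb_metric_space
begin

lemma triangle:
  assumes "Sb_symmetric X S" "u \<in> X" "v \<in> X" "t \<in> X"
  shows "S u u v \<le> s * (2 * S u u t + S t t v)"
  using ineq[of u u v t] assms by (simp add: Sb_symmetric_def)

text \<open>A real \<open>SUP\<close> bounds its members only if they are bounded above, so this is
  what allows a single point to be compared with \<open>H_b\<close>. One point \<open>r\<close> of
  \<open>R\<close> bounds the infimum, and the detour through a fixed \<open>p0\<close> bounds
  \<open>S p p r\<close> by the bound \<open>M\<close> on \<open>P\<close> and the constant
  \<open>S r r p0\<close>.\<close>

lemma bdd_above_D_b:
  assumes P: "Sb_bounded X S P" and R: "R \<subseteq> X" "R \<noteq> {}"
  shows "bdd_above ((\<lambda>p. D_b S p R) ` P)"
proof (cases "P = {}")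
  case False
  then obtain p0 where p0: "p0 \<in> P" by blast
  obtain r where r: "r \<in> R" using R by blast
  have PX: "P \<subseteq> X" using P by (simp add: Sb_bounded_def)
  obtain M where "\<forall>x\<in>{S h u v |h u v. h \<in> P \<and> u \<in> P \<and> v \<in> P}. x \<le> M"
    using P unfolding Sb_bounded_def bdd_above_def by blast
  then have M: "S h u v \<le> M" if "h \<in> P" "u \<in> P" "v \<in> P" for h u v
    using that by blast
  have "D_b S p R \<le> s * (2 * M + S r r p0)" if p: "p \<in> P" for p
  proof -
    have "bdd_below ((\<lambda>r. S p p r) ` R)"
      using nonneg p PX R by (intro bdd_belowI2[of _ 0]) blast
    then have "D_b S p R \<le> S p p r"
      unfolding D_b_def using r by (rule cINF_lower)
    also have "\<dots> \<le> s * (S p p p0 + S p p p0 + S r r p0)"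
      using ineq p p0 r PX R by blast
    also have "\<dots> \<le> s * (2 * M + S r r p0)"
      using M[OF p p p0] s_ge_1 by (intro mult_left_mono) auto
    finally show ?thesis .
  qed
  then show ?thesis by (rule bdd_aboveI2)
qed simp

text \<open>\<open>H_b\<close> dominates \<open>D_b S x R\<close>, and an infimum strictly below
  \<open>e\<close> is undercut by some element. The strict inequality compensates for an infimum
  that may not be attained.\<close>

lemma H_b_less_imp_near:
  assumes P: "P \<in> CB X S" and R: "R \<in> CB X S" and x: "x \<in> P" and "H_b S P P R < e"
  shows "\<exists>r\<in>R. S x x r < e"
proof -
  have R': "R \<subseteq> X" "R \<noteq> {}" using R by (auto simp: CB_def Sb_closed_def)
  have P': "Sb_bounded X S P" and xX: "x \<in> X" using P x by (auto simp: CB_def Sb_bounded_def)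
  have "D_b S x R \<le> (SUP p\<in>P. D_b S p R)"
    using x bdd_above_D_b[OF P' R'] by (rule cSUP_upper)
  also have "\<dots> \<le> H_b S P P R"
    by (simp add: H_b_def le_max_iff_disj)
  finally have "(INF r\<in>R. S x x r) < e" using assms(4) by (simp add: D_b_def)
  moreover have "bdd_below ((\<lambda>r. S x x r) ` R)"
    using nonneg xX R' by (intro bdd_belowI2[of _ 0]) blast
  ultimately show ?thesis using R' by (simp add: cINF_less_iff)
qed

text \<open>Splitting off the first step of a stretch of the sequence puts a factor \<open>s\<close>
  on the rest, but the rest starts one index later and gains a factor \<open>k\<close>. As
  \<open>s * k < 1\<close>, one bound \<open>C * k ^ n\<close> serves stretches of every
  length.\<close>

lemma geometric_steps_imp_Cauchy:
  assumes sym: "Sb_symmetric X S" and xX: "\<And>n. x n \<in> X"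
    and k: "0 \<le> k" "s * k < 1" and step: "\<And>n. S (x n) (x n) (x (Suc n)) \<le> c * k ^ n"
  shows "Sb_Cauchy X S x"
proof -
  \<comment> \<open>The solution of \<open>C = s * (2 * c + k * C)\<close>, the equation under which
    the tail bound reproduces itself in the induction on \<open>j\<close>.\<close>
  define C where "C = 2 * s * c / (1 - s * k)"
  have C: "s * (2 * c + k * C) = C" using k by (simp add: C_def field_simps)
  have "0 \<le> c" using step[of 0] nonneg[OF xX xX xX, of 0 0 1] by simp
  then have C0: "0 \<le> C" using k s_ge_1 by (simp add: C_def)
  have tail: "S (x n) (x n) (x (n + j)) \<le> C * k ^ n" for n j
  proof (induction j arbitrary: n)
    case 0
    then show ?case using eq_0_iff[OF xX xX xX, of n n n] C0 k by simp
  next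
    case (Suc j)
    have "S (x n) (x n) (x (n + Suc j))
        \<le> s * (2 * S (x n) (x n) (x (Suc n)) + S (x (Suc n)) (x (Suc n)) (x (Suc n + j)))"
      using triangle[OF sym xX xX xX, of n "n + Suc j" "Suc n"] by simp
    also have "\<dots> \<le> s * (2 * (c * k ^ n) + C * k ^ Suc n)"
      using step[of n] Suc[of "Suc n"] s_ge_1 by (intro mult_left_mono add_mono) auto
    also have "\<dots> = (s * (2 * c + k * C)) * k ^ n" by (simp add: algebra_simps)
    finally show ?case by (simp only: C)
  qed
  have "k * 1 \<le> k * s" using k s_ge_1 by (intro mult_left_mono) auto
  then have k1: "k < 1" using k by (simp add: mult.commute)
  show ?thesis unfolding Sb_Cauchy_def
  proof (intro conjI allI impI)
    show "range x \<subseteq> X" using xX by auto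
    fix e :: real assume "0 < e"
    have "(\<lambda>n. C * k ^ n) \<longlonglongrightarrow> C * 0"
      using k k1 by (intro tendsto_intros LIMSEQ_power_zero) simp
    then have "\<forall>\<^sub>F n in sequentially. C * k ^ n < e"
      by (rule order_tendstoD(2)) (use \<open>0 < e\<close> in simp)
    then obtain N where N: "\<And>n. N \<le> n \<Longrightarrow> C * k ^ n < e"
      by (auto simp: eventually_sequentially)
    have less: "S (x n) (x n) (x m) < e" if "N \<le> n" "n \<le> m" for n m
      using tail[of n "m - n"] N[of n] that by simp
    \<comment> \<open>Symmetry swaps the indices when \<open>m < n\<close>.\<close>
    have "S (x n) (x n) (x m) < e" if "N \<le> n" "N \<le> m" for n m
    proof (cases "n \<le> m")
      case False
      then show ?thesis using less[of m n] that sym xX by (simp add: Sb_symmetric_def)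
    qed (use less that in simp)
    then show "\<exists>N. \<forall>n\<ge>N. \<forall>m\<ge>N. S (x n) (x n) (x m) < e" by blast
  qed
qed

end

theorem theorem3p1:
  fixes X :: "'a set"
    and S :: "'a \<Rightarrow> 'a \<Rightarrow> 'a \<Rightarrow> real"
    and s \<alpha> :: real
    and T :: "'a \<Rightarrow> 'a set"
  assumes "Sb_metric_space X S s"
    and "Sb_symmetric X S"
    and "Sb_complete X S"
    and "\<forall>h\<in>X. T h \<in> CB X S"
    and "Sb_multi_continuous X S T"
    and "0 \<le> \<alpha>" and "\<alpha> < 1 / s"
    and "\<forall>h\<in>X. \<forall>g\<in>X. H_b S (T h) (T h) (T g) \<le> \<alpha> * S h h g"
  shows "\<exists>z\<in>X. z \<in> T z"
proof (rule ccontr)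
  interpret Sb_metric_space X S s by fact
  note sym = assms(2) and CB = assms(4)[rule_format] and contr = assms(8)[rule_format]
  assume "\<not> (\<exists>z\<in>X. z \<in> T z)"
  then have nofix: "\<And>z. z \<in> X \<Longrightarrow> z \<notin> T z" by blast
  have TX: "T h \<subseteq> X" "T h \<noteq> {}" if "h \<in> X" for h
    using CB[OF that] by (auto simp: CB_def Sb_closed_def)
  obtain k where k: "\<alpha> < k" "k < 1 / s" using assms(7) dense by blast
  have k0: "0 \<le> k" and sk: "s * k < 1" using k assms(6) s_ge_1 by (auto simp: field_simps)
  have near: "\<exists>r\<in>T g. S y y r < e"
    if "h \<in> X" "g \<in> X" "y \<in> T h" "\<alpha> * S h h g < e" for h g y e
    using H_b_less_imp_near[OF CB CB, of h g y e] contr[of h g] that by simp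
  have ex_next: "\<exists>z\<in>T y. S y y z \<le> k * S x x y" if x: "x \<in> X" and y: "y \<in> T x" for x y
  proof -
    have yX: "y \<in> X" using TX x y by blast
    have "S x x y \<noteq> 0" using nofix x y eq_0_iff[OF x x yX] by blast
    then have "\<alpha> * S x x y < k * S x x y" using nonneg[OF x x yX] k by simp
    from near[OF x yX y this] show ?thesis by (auto intro: less_imp_le)
  qed
  obtain x0 x1 where x01: "x0 \<in> X" "x1 \<in> T x0" using nonempty TX by blast
  \<comment> \<open>The choice of the next point depends on the last two, through the length of the
    step between them; hence the recursion runs on pairs of consecutive orbit points.\<close>
  have "\<exists>f :: nat \<Rightarrow> 'a \<times> 'a. \<forall>n. (fst (f n) \<in> X \<and> snd (f n) \<in> T (fst (f n))) \<and>
      (fst (f (Suc n)) = snd (f n) \<and>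
       S (snd (f n)) (snd (f n)) (snd (f (Suc n))) \<le> k * S (fst (f n)) (fst (f n)) (snd (f n)))"
    (is "\<exists>f. \<forall>n. ?P (f n) \<and> ?Q (f n) (f (Suc n))")
  proof (rule dependent_nat_choice[where P = "\<lambda>_. ?P" and Q = "\<lambda>_. ?Q"])
    show "\<exists>p. ?P p" using x01 by (intro exI[of _ "(x0, x1)"]) simp
    fix p assume p: "?P p"
    then obtain z where "z \<in> T (snd p)" "S (snd p) (snd p) z \<le> k * S (fst p) (fst p) (snd p)"
      using ex_next by blast
    then show "\<exists>q. ?P q \<and> ?Q p q" using p TX by (intro exI[of _ "(snd p, z)"]) auto
  qed
  then obtain f where f: "\<And>n. ?P (f n)" "\<And>n. ?Q (f n) (f (Suc n))" by blast
  define x where "x n = fst (f n)" for n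
  have x_Suc: "x (Suc n) = snd (f n)" for n using f(2) by (simp add: x_def)
  have xX: "x n \<in> X" and xT: "x (Suc n) \<in> T (x n)" for n
    using f(1)[of n] by (simp_all only: x_Suc) (simp_all add: x_def)
  have ratio: "S (x (Suc n)) (x (Suc n)) (x (Suc (Suc n))) \<le> k * S (x n) (x n) (x (Suc n))" for n
    using f(2)[of n] by (simp only: x_Suc) (simp add: x_def)
  have step: "S (x n) (x n) (x (Suc n)) \<le> S (x 0) (x 0) (x 1) * k ^ n" for n
  proof (induction n)
    case (Suc n)
    then show ?case using ratio[of n] mult_left_mono[OF Suc k0] by (simp add: ac_simps)
  qed simp
  have "Sb_Cauchy X S x" using geometric_steps_imp_Cauchy[OF sym xX k0 sk step] .
  then obtain z where z: "Sb_converges X S x z"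
    using assms(3) by (auto simp: Sb_complete_def)
  then have zX: "z \<in> X" and lim: "(\<lambda>n. S (x n) (x n) z) \<longlonglongrightarrow> 0"
    by (auto simp: Sb_converges_def)
  \<comment> \<open>The slack \<open>1 / real (Suc n)\<close> makes the bound required by
    \<open>near\<close> strict, even if \<open>\<alpha> * S (x n) (x n) z\<close> is zero, and
    vanishes in the limit.\<close>
  have "\<exists>r\<in>T z. S (x (Suc n)) (x (Suc n)) r < \<alpha> * S (x n) (x n) z + 1 / real (Suc n)" for n
    by (rule near[OF xX zX xT]) simp
  then obtain r where r: "\<And>n. r n \<in> T z"
    "\<And>n. S (x (Suc n)) (x (Suc n)) (r n) < \<alpha> * S (x n) (x n) z + 1 / real (Suc n)"
    by metis
  have rX: "r n \<in> X" for n using r(1) TX zX by blast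
  \<comment> \<open>The intermediate point is \<open>x (Suc n)\<close>: it is close to
    \<open>r n\<close> by choice and to \<open>z\<close> by convergence, so \<open>r\<close>
    converges to \<open>z\<close> inside \<open>T z\<close>.\<close>
  have ub: "S (r n) (r n) z
      \<le> s * (2 * (\<alpha> * S (x n) (x n) z + 1 / real (Suc n)) + S (x (Suc n)) (x (Suc n)) z)" for n
  proof -
    have "S (r n) (r n) z \<le> s * (2 * S (r n) (r n) (x (Suc n)) + S (x (Suc n)) (x (Suc n)) z)"
      using triangle[OF sym rX zX xX] .
    also have "S (r n) (r n) (x (Suc n)) = S (x (Suc n)) (x (Suc n)) (r n)"
      using sym rX xX by (simp add: Sb_symmetric_def)
    also have "s * (2 * S (x (Suc n)) (x (Suc n)) (r n) + S (x (Suc n)) (x (Suc n)) z)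
        \<le> s * (2 * (\<alpha> * S (x n) (x n) z + 1 / real (Suc n)) + S (x (Suc n)) (x (Suc n)) z)"
      using r(2)[of n] s_ge_1 by (intro mult_left_mono add_mono) auto
    finally show ?thesis .
  qed
  have "(\<lambda>n. s * (2 * (\<alpha> * S (x n) (x n) z + 1 / real (Suc n)) + S (x (Suc n)) (x (Suc n)) z))
      \<longlonglongrightarrow> s * (2 * (\<alpha> * 0 + 0) + 0)"
    by (intro tendsto_mult tendsto_add tendsto_const lim LIMSEQ_Suc[OF lim]
        LIMSEQ_inverse_real_of_nat[unfolded inverse_eq_divide])
  then have "(\<lambda>n. S (r n) (r n) z) \<longlonglongrightarrow> 0"
    using tendsto_sandwich[OF always_eventually always_eventually tendsto_const,
        OF allI allI, OF nonneg[OF rX rX zX] ub] by simp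
  then have "Sb_converges X S r z" using rX zX by (auto simp: Sb_converges_def)
  moreover have "range r \<subseteq> T z" using r(1) by blast
  ultimately have "z \<in> T z" using CB[OF zX] zX unfolding CB_def Sb_closed_def by blast
  then show False using nofix zX by blast
qed

end
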